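(* Let $\ell$ be a non-negative integer and fix a tree degree sequence. Among all trees with this degree sequence, the greedy tree maximizes the number of vertices $z$ with $\operatorname{ecc}_T(z)\leq\ell$. In particular, the greedy tree minimizes $\operatorname{Ecc}(T)$ among trees with the given degree sequence.
   Context: For a vertex $v$ of a tree $T$, $\operatorname{ecc}_T(v)=\max_{u\in V(T)} d_T(u,v)$, and $\operatorname{Ecc}(T)=\sum_{z\in V(T)}\operatorname{ecc}_T(z)$. Greedy tree: given a tree degree sequence $d_1\geq d_2\geq\cdots\geq d_n$ in non-increasing order, build a rooted tree level by level: the root has degree $d_1$; the $d_1$ vertices at height 1 receive the next largest degrees $d_2,\ldots,d_{d_1+1}$; in general the vertices at height $i+1$ (whose number is the sum over vertices $x$ at height $i\geq1$ of $\deg(x)-1$) receive the next largest unused degrees, so that every degree at a level is at most every degree at the previous level. Within each level vertices are ordered left to right by non-increasing degree, and, processing the vertices of each level from left to right, each vertex is joined to the first as yet unconnected vertices of the next level, as many as its down-degree (degree for the root, degree minus one otherwise). *)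

theory Defs
  imports "Graph_Theory.Graph_Theory"
begin

text \<open>
  A finite simple undirected graph is a \<^locale>\<open>pair_graph\<close>: a finite vertex set with a
  symmetric irreflexive set of pairs as arcs, each edge being a pair of opposite arcs. Every edge
  is thus a directed cycle of length 2, so \<^const>\<open>forest\<close> and \<^const>\<open>tree\<close> are useless for
  such graphs; the cycles of the undirected graph are the directed cycles of length at least 3.
\<close>

definition undirected_tree :: "'a pair_pre_digraph \<Rightarrow> bool" where
  "undirected_tree T \<longleftrightarrow>
     pair_graph T \<and> connected T \<and> \<not> (\<exists>p. pre_digraph.cycle T p \<and> length p \<ge> 3)"

text \<open>In a \<^locale>\<open>pair_graph\<close>, \<^const>\<open>out_degree\<close> is the number of neighbours.\<close>

definition has_degree_sequence :: "'a pair_pre_digraph \<Rightarrow> nat list \<Rightarrow> bool" where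
  "has_degree_sequence T ds \<longleftrightarrow> image_mset (out_degree T) (mset_set (pverts T)) = mset ds"

text \<open>Every finite graph has an isomorphic copy with natural numbers as vertices.\<close>

definition tree_degree_sequence :: "nat list \<Rightarrow> bool" where
  "tree_degree_sequence ds \<longleftrightarrow>
     (\<exists>T :: nat pair_pre_digraph. undirected_tree T \<and> has_degree_sequence T ds)"

definition graph_dist :: "'a pair_pre_digraph \<Rightarrow> 'a \<Rightarrow> 'a \<Rightarrow> nat" where
  "graph_dist T u v = (INF p \<in> {p. pre_digraph.awalk T u p v}. length p)"

definition ecc :: "'a pair_pre_digraph \<Rightarrow> 'a \<Rightarrow> nat" where
  "ecc T v = Max ((\<lambda>u. graph_dist T u v) ` pverts T)"

definition Ecc :: "'a pair_pre_digraph \<Rightarrow> nat" where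
  "Ecc T = (\<Sum>z\<in>pverts T. ecc T z)"

text \<open>
  The vertices of the greedy tree are numbered from 0 in the order of construction: level by
  level, and from left to right within each level. As every level takes the largest unused
  degrees and is sorted by non-increasing degree, vertex \<open>k\<close> receives the degree \<open>ds ! k\<close>
  of the non-increasing list \<open>ds\<close>.
\<close>

definition down_degree :: "nat list \<Rightarrow> nat \<Rightarrow> nat" where
  "down_degree ds k = (if k = 0 then ds ! k else ds ! k - 1)"

text \<open>\<open>greedy_level ds h = (a, b)\<close> means that level \<open>h\<close> consists of the vertices \<open>{a..<b}\<close>.\<close>

primrec greedy_level :: "nat list \<Rightarrow> nat \<Rightarrow> nat \<times> nat" where
  "greedy_level ds 0 = (0, 1)"
| "greedy_level ds (Suc h) =
     (case greedy_level ds h of (a, b) \<Rightarrow> (b, b + (\<Sum>k\<in>{a..<b}. down_degree ds k)))"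

text \<open>
  The next level starts with vertex \<open>b\<close>, and the vertices of level \<open>h\<close> to the left of \<open>k\<close> have
  already taken its first \<open>\<Sum>j\<in>{a..<k}. down_degree ds j\<close> vertices.
\<close>

definition greedy_arcs :: "nat list \<Rightarrow> nat rel" where
  "greedy_arcs ds =
     {(k, c). \<exists>h a b. greedy_level ds h = (a, b) \<and> k \<in> {a..<b} \<and>
        (let s = b + (\<Sum>j\<in>{a..<k}. down_degree ds j) in c \<in> {s..<s + down_degree ds k})}"

definition greedy_tree :: "nat list \<Rightarrow> nat pair_pre_digraph" where
  "greedy_tree ds =
     \<lparr> pverts = {..<length ds}, parcs = greedy_arcs ds \<union> (greedy_arcs ds)\<inverse> \<rparr>"

end

theory Submission
  imports Defs
begin

text \<open>
  Let \<open>r\<close> be the least eccentricity in a tree \<open>T\<close>. The centre \<open>C\<close>, the set of vertices of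
  eccentricity \<open>r\<close>, is a vertex or an edge, and every other vertex has a neighbour of smaller
  eccentricity. Hence a vertex of eccentricity at most \<open>r + k\<close> is within distance \<open>k\<close> of \<open>C\<close>, and
  all vertices are within distance \<open>r + 1 - card C\<close> of \<open>C\<close>.

  A connected set \<open>B\<close> of \<open>m\<close> vertices has at most \<open>2 + (\<Sum>x\<in>B. deg x - 1)\<close> vertices in its closed
  neighbourhood, which is at most \<open>F m = 2 + (\<Sum>j<m. ds ! j - 1)\<close>. So the \<open>k\<close>-ball around \<open>C\<close> has at
  most \<open>(F ^^ k) (card C)\<close> vertices. In the greedy tree, \<open>F m\<close> is also the first child of \<open>m\<close>, so the
  \<open>k\<close>-ball around \<open>{0}\<close> or \<open>{0, 1}\<close> consists of exactly the first \<open>(F ^^ k) 1\<close> or \<open>(F ^^ k) 2\<close>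
  vertices. These have eccentricity at most \<open>r + k\<close>, since the ball of radius \<open>r + 1 - card C\<close> already
  contains every vertex.
\<close>

section \<open>Distances and balls in connected graphs\<close>

text \<open>Iterating it \<open>k\<close> times gives the ball of radius \<open>k\<close>, grown one
  layer at a time.\<close>

definition nbhd :: "'a rel \<Rightarrow> 'a set \<Rightarrow> 'a set" where
  "nbhd E B = B \<union> E `` B"

text \<open>Relation powers allow induction on the length of a walk. For \<open>k = 0\<close> the
  empty walk exists only at a vertex, whence the hypothesis on \<open>u\<close>.\<close>

lemma (in pair_wf_digraph) relpow_iff_awalk:
  assumes "u \<in> pverts G"
  shows "(u, v) \<in> parcs G ^^ k \<longleftrightarrow> (\<exists>p. awalk u p v \<and> length p = k)"
  using assms
proof (induction k arbitrary: u)
  case 0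
  then show ?case by (auto simp: awalk_Nil_iff)
next
  case (Suc k)
  have "(u, v) \<in> parcs G ^^ Suc k \<longleftrightarrow> (\<exists>w. (u, w) \<in> parcs G \<and> (w, v) \<in> parcs G ^^ k)"
    by (metis relpow_Suc_D2 relpow_Suc_I2)
  also have "\<dots> \<longleftrightarrow> (\<exists>w. (u, w) \<in> parcs G \<and> (\<exists>p. awalk w p v \<and> length p = k))"
    using Suc.IH in_arcsD2 by blast
  also have "\<dots> \<longleftrightarrow> (\<exists>p. awalk u p v \<and> length p = Suc k)"
  proof
    assume "\<exists>w. (u, w) \<in> parcs G \<and> (\<exists>p. awalk w p v \<and> length p = k)"
    then obtain w p where "(u, w) \<in> parcs G" "awalk w p v" "length p = k" by blast
    then show "\<exists>p. awalk u p v \<and> length p = Suc k"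
      by (intro exI[of _ "(u, w) # p"]) (simp add: awalk_Cons_iff)
  next
    assume "\<exists>p. awalk u p v \<and> length p = Suc k"
    then obtain e p where "awalk u (e # p) v" "length p = k" by (metis length_Suc_conv)
    then show "\<exists>w. (u, w) \<in> parcs G \<and> (\<exists>p. awalk w p v \<and> length p = k)"
      by (metis awalk_Cons_iff prod.collapse)
  qed
  finally show ?case .
qed

locale connected_pair_graph = pair_graph T for T :: "'a pair_pre_digraph" +
  assumes is_connected: "connected T"
begin

abbreviation "V \<equiv> pverts T"
abbreviation "E \<equiv> parcs T"
abbreviation "d \<equiv> graph_dist T"

lemma adj_sym: "(x, y) \<in> E \<Longrightarrow> (y, x) \<in> E"
  by (rule arcs_symmetric)

lemma adj_verts: "(x, y) \<in> E \<Longrightarrow> x \<in> V" "(x, y) \<in> E \<Longrightarrow> y \<in> V"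
  using in_arcsD1 in_arcsD2 by auto

lemma verts_nonempty: "V \<noteq> {}"
  using is_connected by (auto simp: connected_def strongly_connected_def)

lemma relpow_sym: "(x, y) \<in> E ^^ k \<Longrightarrow> (y, x) \<in> E ^^ k"
proof (induction k arbitrary: y)
  case (Suc k)
  then show ?case by (metis relpow_Suc_E relpow_Suc_I2 adj_sym)
qed simp

lemma connected_relpow:
  assumes "x \<in> V" "y \<in> V"
  obtains k where "(x, y) \<in> E ^^ k"
proof -
  have "x \<rightarrow>\<^sup>*\<^bsub>mk_symmetric T\<^esub> y"
    using is_connected assms by (auto simp: connected_def strongly_connected_def)
  then have "x \<rightarrow>\<^sup>*\<^bsub>T\<^esub> y" by (simp add: reachable_mk_symmetric_eq sym_arcs)
  then obtain p where "awalk x p y" by (auto simp: reachable_awalk)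
  then show thesis using that relpow_iff_awalk assms by blast
qed

lemma dist_eq_Least:
  assumes "x \<in> V"
  shows "d x y = (LEAST k. (x, y) \<in> E ^^ k)"
proof -
  have "length ` {p. awalk x p y} = {k. (x, y) \<in> E ^^ k}"
    using assms by (auto simp: relpow_iff_awalk)
  then show ?thesis by (simp add: graph_dist_def Inf_nat_def)
qed

lemma dist_relpow:
  assumes "x \<in> V" "y \<in> V"
  shows "(x, y) \<in> E ^^ d x y"
  using assms by (metis connected_relpow dist_eq_Least LeastI)

lemma dist_le:
  assumes "(x, y) \<in> E ^^ k" "x \<in> V"
  shows "d x y \<le> k"
  using assms by (simp add: dist_eq_Least Least_le)

lemma dist_sym:
  assumes "x \<in> V" "y \<in> V"
  shows "d x y = d y x"
  using assms by (meson antisym dist_le relpow_sym dist_relpow)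

lemma dist_triangle:
  assumes "x \<in> V" "y \<in> V" "z \<in> V"
  shows "d x z \<le> d x y + d y z"
  using assms dist_relpow[of x y] dist_relpow[of y z] dist_le[of x z "d x y + d y z"]
  by (auto simp: relpow_add)

lemma dist_self [simp]: "x \<in> V \<Longrightarrow> d x x = 0"
  using dist_le[of x x 0] by simp

lemma dist_eq_0:
  assumes "x \<in> V" "y \<in> V" "d x y = 0"
  shows "x = y"
  using dist_relpow[OF assms(1,2)] assms(3) by simp

lemma dist_adj_le: "(x, y) \<in> E \<Longrightarrow> d x y \<le> 1"
  using dist_le[of x y 1] adj_verts by simp

lemma dist_Suc_neighbour:
  assumes "x \<in> V" "y \<in> V" "d x y = Suc k"
  obtains z where "(x, z) \<in> E" "d z y = k"
proof -
  obtain z where z: "(x, z) \<in> E" "(z, y) \<in> E ^^ k"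
    using dist_relpow[OF assms(1,2)] assms(3) relpow_Suc_D2 by metis
  then have "z \<in> V" by (auto dest: adj_verts)
  have "d z y \<le> k" using z \<open>z \<in> V\<close> by (intro dist_le)
  moreover have "Suc k \<le> d x z + d z y"
    using dist_triangle[of x z y] assms \<open>z \<in> V\<close> by simp
  moreover have "d x z \<le> 1" using z by (intro dist_adj_le)
  ultimately show thesis using that[of z] z by simp
qed

section \<open>Eccentricities, balls and the growth of balls\<close>

lemma ecc_le_iff:
  assumes "z \<in> V"
  shows "ecc T z \<le> m \<longleftrightarrow> (\<forall>u\<in>V. d u z \<le> m)"
  using verts_nonempty finite_verts by (simp add: ecc_def)

lemma nbhd_subset_verts: "B \<subseteq> V \<Longrightarrow> nbhd E B \<subseteq> V"
  by (auto simp: nbhd_def dest: adj_verts)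

lemma nbhd_pow_subset_verts: "B \<subseteq> V \<Longrightarrow> (nbhd E ^^ k) B \<subseteq> V"
  by (induction k) (auto dest: nbhd_subset_verts)

lemma subset_nbhd_pow: "B \<subseteq> (nbhd E ^^ k) B"
  by (induction k) (auto simp: nbhd_def)

lemma dist_le_imp_nbhd_pow:
  assumes "x \<in> V" "c \<in> B" "c \<in> V" "d x c \<le> k"
  shows "x \<in> (nbhd E ^^ k) B"
  using assms
proof (induction k arbitrary: x)
  case 0
  then show ?case using dist_eq_0[of x c] by auto
next
  case (Suc k)
  show ?case
  proof (cases "d x c \<le> k")
    case True
    then show ?thesis using Suc by (auto simp: nbhd_def[of _ "(nbhd E ^^ k) B"])
  next
    case False
    then have "d x c = Suc k" using Suc.prems by simp
    then obtain z where z: "(x, z) \<in> E" "d z c = k"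
      using dist_Suc_neighbour Suc.prems by blast
    then have "z \<in> (nbhd E ^^ k) B" using Suc adj_verts by auto
    then show ?thesis using adj_sym[OF z(1)] by (auto simp: nbhd_def[of _ "(nbhd E ^^ k) B"])
  qed
qed

lemma out_degree_eq: "out_degree T x = card (E `` {x})"
proof -
  have "out_arcs T x = Pair x ` (E `` {x})" by (auto simp: out_arcs_def)
  then show ?thesis by (simp add: out_degree_def card_image inj_on_def)
qed

lemma finite_neighbours: "finite (E `` B)"
  using finite_subset[of "E `` B" V] finite_verts adj_verts by auto

lemma out_degree_pos:
  assumes "card V \<ge> 2" "x \<in> V"
  shows "out_degree T x \<ge> 1"
proof -
  have "\<not> V \<subseteq> {x}" using assms card_mono[of "{x}" V] by auto
  then obtain y where y: "y \<in> V" "y \<noteq> x" by auto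
  then have "d x y \<noteq> 0" using assms dist_eq_0 by metis
  then obtain z where "(x, z) \<in> E"
    using dist_Suc_neighbour[of x y] assms y not0_implies_Suc by metis
  then have "E `` {x} \<noteq> {}" by auto
  then show ?thesis using finite_neighbours[of "{x}"]
    by (simp add: out_degree_eq Suc_le_eq card_gt_0_iff)
qed

text \<open>
  The bound \<open>card (nbhd E B) \<le> 2 + (\<Sum>x\<in>B. deg x - 1)\<close>, rearranged to avoid
  truncated subtraction.
\<close>

definition few_neighbours :: "'a set \<Rightarrow> bool" where
  "few_neighbours B \<longleftrightarrow> card (nbhd E B) + card B \<le> 2 + (\<Sum>x\<in>B. out_degree T x)"

lemma few_neighbours_singleton: "few_neighbours {x}"
  using card_Un_le[of "{x}" "E `` {x}"]
  by (simp add: few_neighbours_def nbhd_def out_degree_eq)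

text \<open>A new vertex \<open>x\<close> already lies in the neighbourhood and has a neighbour
  \<open>y\<close> in \<open>B\<close>, which is counted too. So \<open>x\<close> contributes at
  most \<open>deg x - 1\<close> further vertices.\<close>

lemma few_neighbours_insert:
  assumes "few_neighbours B" "finite B" "x \<in> nbhd E B"
  shows "few_neighbours (insert x B)"
proof (cases "x \<in> B")
  case True
  then show ?thesis using assms by (simp add: insert_absorb)
next
  case False
  then obtain y where y: "y \<in> B" "(y, x) \<in> E" using assms by (auto simp: nbhd_def)
  have "nbhd E (insert x B) \<subseteq> nbhd E B \<union> (E `` {x} - {y})"
    using assms y by (auto simp: nbhd_def)
  then have "card (nbhd E (insert x B)) \<le> card (nbhd E B \<union> (E `` {x} - {y}))"
    using assms by (intro card_mono) (auto simp: nbhd_def finite_neighbours)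
  also have "\<dots> \<le> card (nbhd E B) + card (E `` {x} - {y})" by (rule card_Un_le)
  also have "card (E `` {x} - {y}) = out_degree T x - 1"
    using y by (simp add: out_degree_eq card_Diff_singleton adj_sym)
  finally have "card (nbhd E (insert x B)) \<le> card (nbhd E B) + (out_degree T x - 1)" .
  moreover have "out_degree T x \<ge> 1"
    using adj_sym[OF y(2)] finite_neighbours[of "{x}"]
    by (auto simp: out_degree_eq Suc_le_eq card_gt_0_iff)
  ultimately show ?thesis using assms False by (simp add: few_neighbours_def)
qed

text \<open>The vertices of the neighbourhood are added one at a time; each stays in the closed
  neighbourhood of the growing set.\<close>

lemma few_neighbours_nbhd:
  assumes "few_neighbours B" "B \<subseteq> V"
  shows "few_neighbours (nbhd E B)"
proof -
  have fin: "finite B" using assms finite_verts finite_subset by blast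
  have "few_neighbours (B \<union> D)" if "finite D" "D \<subseteq> nbhd E B" for D
    using that
  proof (induction D rule: finite_induct)
    case empty
    then show ?case using assms by simp
  next
    case (insert x D)
    then have "x \<in> nbhd E (B \<union> D)" by (auto simp: nbhd_def)
    then have "few_neighbours (insert x (B \<union> D))"
      using insert fin by (intro few_neighbours_insert) auto
    then show ?case by simp
  qed
  moreover have "finite (nbhd E B)" using fin finite_neighbours by (simp add: nbhd_def)
  moreover have "B \<union> nbhd E B = nbhd E B" by (auto simp: nbhd_def)
  ultimately show ?thesis by (metis order_refl)
qed

lemma few_neighbours_nbhd_pow:
  assumes "few_neighbours B" "B \<subseteq> V"
  shows "few_neighbours ((nbhd E ^^ k) B)"
  by (induction k) (use assms nbhd_pow_subset_verts few_neighbours_nbhd in auto)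

text \<open>The growth bound for \<open>B = V\<close>, which is a ball around any vertex and its own
  closed neighbourhood. It says that a connected graph has at least \<open>card V - 1\<close>
  edges.\<close>

lemma sum_out_degree_ge: "2 * card V \<le> 2 + (\<Sum>x\<in>V. out_degree T x)"
proof -
  obtain c where c: "c \<in> V" using verts_nonempty by auto
  obtain K where K: "ecc T c \<le> K" by auto
  have "V \<subseteq> (nbhd E ^^ K) {c}"
    using K c by (auto simp: ecc_le_iff intro: dist_le_imp_nbhd_pow)
  then have *: "(nbhd E ^^ K) {c} = V" using nbhd_pow_subset_verts[of "{c}" K] c by auto
  have "nbhd E V = V" by (auto simp: nbhd_def dest: adj_verts)
  then show ?thesis
    using few_neighbours_nbhd_pow[OF few_neighbours_singleton, of c K] c *
    by (simp add: few_neighbours_def)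
qed

end

section \<open>Trees and their centres\<close>

locale undirected_tree_graph = connected_pair_graph +
  assumes no_cycle: "\<not> (\<exists>p. cycle p \<and> length p \<ge> 3)"

lemma undirected_tree_iff: "undirected_tree T \<longleftrightarrow> undirected_tree_graph T"
  unfolding undirected_tree_def undirected_tree_graph_def connected_pair_graph_def
      undirected_tree_graph_axioms_def connected_pair_graph_axioms_def by blast

context undirected_tree_graph
begin

section \<open>Deleting an edge of a tree\<close>

text \<open>A walk from \<open>a\<close> to \<open>b\<close> avoiding the edge shortens to a path,
  which the arc \<open>(b, a)\<close> closes into a cycle.\<close>

lemma bridge:
  assumes "(a, b) \<in> E"
  shows "(a, b) \<notin> (E - {(a, b), (b, a)})\<^sup>*"
proof
  define H where "H = \<lparr>pverts = V, parcs = E - {(a, b), (b, a)}\<rparr>"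
  assume *: "(a, b) \<in> (E - {(a, b), (b, a)})\<^sup>*"
  interpret H: pair_wf_digraph H
    by unfold_locales (auto simp: H_def dest: adj_verts)
  have "a \<in> pverts H" "a \<noteq> b" using assms no_loops' by (auto simp: H_def dest: adj_verts)
  obtain k where "(a, b) \<in> parcs H ^^ k"
    using * by (auto simp: H_def rtrancl_power)
  then obtain q where "H.awalk a q b" using H.relpow_iff_awalk \<open>a \<in> pverts H\<close> by blast
  then obtain p where p: "H.apath a p b" by (metis H.reachable_awalk H.reachable_apath)
  then have "set p \<subseteq> parcs H" "pcas a p b" "distinct (pawalk_verts a p)"
    by (auto simp: H.apath_def H.awalk_def)
  then have aw: "set p \<subseteq> E - {(a, b), (b, a)}" "pcas a p b" "distinct (pawalk_verts a p)"
    by (auto simp: H_def)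
  \<comment> \<open>The only path of length 1 is the arc \<open>(a, b)\<close>, which is missing
    from \<open>H\<close>.\<close>
  have "length p \<ge> 2"
  proof (cases p)
    case Nil
    then show ?thesis using aw \<open>a \<noteq> b\<close> by auto
  next
    case (Cons e p')
    then show ?thesis using aw by (cases p') auto
  qed
  have "awalk b ((b, a) # p) b"
    using assms aw adj_sym adj_verts by (auto simp: awalk_def)
  then have "cycle ((b, a) # p)"
    using aw by (auto simp: cycle_def intro!: exI[of _ b])
  then show False using no_cycle \<open>length p \<ge> 2\<close> by (metis length_Cons Suc_le_mono numeral_2_eq_2 numeral_3_eq_3)
qed

text \<open>
  \<open>S\<close> is the side of \<open>a\<close> after deleting the edge.
\<close>

lemma edge_split:
  assumes "(a, b) \<in> E"
  obtains S where "a \<in> S" "b \<notin> S"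
    "\<And>c u. c \<in> V - S \<Longrightarrow> u \<in> V \<inter> S \<Longrightarrow> d c u = d c b + 1 + d a u"
proof -
  define E' where "E' = E - {(a, b), (b, a)}"
  define S where "S = {x. (a, x) \<in> E'\<^sup>*}"
  have aS: "a \<in> S" by (simp add: S_def)
  have bS: "b \<notin> S" using bridge assms by (simp add: S_def E'_def)
  have ab: "a \<in> V" "b \<in> V" using assms adj_verts by auto
  \<comment> \<open>The deleted edge is the only one between \<open>S\<close> and its
    complement.\<close>
  have cross: "y = b \<and> x = a" if "(y, x) \<in> E" "x \<in> S" "y \<notin> S" for x y
  proof -
    have "(x, y) \<notin> E'" using that by (auto simp: S_def dest: rtrancl_into_rtrancl)
    then show ?thesis using that adj_sym aS bS by (auto simp: E'_def)
  qed
  \<comment> \<open>Induction along the walk up to its first entry into \<open>S\<close>, which must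
    be the step from \<open>b\<close> to \<open>a\<close>.\<close>
  have low: "d c b + 1 + d a u \<le> k" if "(c, u) \<in> E ^^ k" "c \<in> V" "c \<notin> S" "u \<in> S" for c u k
    using that
  proof (induction k arbitrary: c)
    case 0
    then show ?case by auto
  next
    case (Suc k)
    then obtain w where w: "(c, w) \<in> E" "(w, u) \<in> E ^^ k" by (metis relpow_Suc_D2)
    have wV: "w \<in> V" using w adj_verts by auto
    show ?case
    proof (cases "w \<in> S")
      case True
      then have "c = b" "w = a" using cross w Suc.prems by auto
      then show ?thesis using dist_le[OF w(2) wV] ab by simp
    next
      case False
      then have "d w b + 1 + d a u \<le> k" using Suc w wV by blast
      moreover have "d c b \<le> 1 + d w b"
        using dist_triangle[of c w b] dist_adj_le[OF w(1)] Suc.prems wV ab by simp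
      ultimately show ?thesis by simp
    qed
  qed
  have "d c u = d c b + 1 + d a u" if "c \<in> V - S" "u \<in> V \<inter> S" for c u
  proof (rule antisym)
    have "d b u \<le> 1 + d a u"
      using dist_triangle[of b a u] dist_adj_le[OF adj_sym[OF assms]] ab that by simp
    then show "d c u \<le> d c b + 1 + d a u"
      using dist_triangle[of c b u] that ab by simp
    show "d c b + 1 + d a u \<le> d c u" using that by (intro low dist_relpow) auto
  qed
  then show thesis using that aS bS by blast
qed

text \<open>Trees are bipartite: \<open>u\<close> lies on one side of the edge, and the end on the
  other side is farther by one.\<close>

lemma dist_adj_neq:
  assumes "(a, b) \<in> E" "u \<in> V"
  shows "d a u \<noteq> d b u"
proof -
  obtain S where S: "a \<in> S" "b \<notin> S"
    "\<And>c u. c \<in> V - S \<Longrightarrow> u \<in> V \<inter> S \<Longrightarrow> d c u = d c b + 1 + d a u"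
    using edge_split[OF assms(1)] by blast
  have ab: "a \<in> V" "b \<in> V" using assms adj_verts by auto
  show ?thesis
  proof (cases "u \<in> S")
    case True
    then show ?thesis using S(3)[of b u] S ab assms by simp
  next
    case False
    then have "d u a = d u b + 1" using S(3)[of u a] S ab assms by simp
    then show ?thesis using dist_sym ab assms by simp
  qed
qed

text \<open>Delete the edge between \<open>v\<close> and \<open>a\<close>. Then \<open>u\<close> is
  on the side of \<open>a\<close>, and a second parent \<open>a'\<close> is on the side of
  \<open>v\<close>, so its way to \<open>u\<close> leads through \<open>v\<close> and is not shorter
  than that of \<open>v\<close>.\<close>

lemma parent_unique:
  assumes "(v, a) \<in> E" "(v, a') \<in> E" "u \<in> V" "d v u = Suc (d a u)" "d v u = Suc (d a' u)"
  shows "a = a'"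
proof (rule ccontr)
  assume "a \<noteq> a'"
  obtain S where S: "a \<in> S" "v \<notin> S"
    "\<And>c u. c \<in> V - S \<Longrightarrow> u \<in> V \<inter> S \<Longrightarrow> d c u = d c v + 1 + d a u"
    using edge_split[OF adj_sym[OF assms(1)]] by blast
  have V: "a \<in> V" "a' \<in> V" "v \<in> V" using assms adj_verts by auto
  have "u \<in> S"
  proof (rule ccontr)
    assume "u \<notin> S"
    then have "d u a = d u v + 1" using S(3)[of u a] S V assms by simp
    then show False using assms V dist_sym by simp
  qed
  moreover have "a' \<notin> S"
  proof
    assume "a' \<in> S"
    then have "d v a' = 1 + d a a'" using S(3)[of v a'] S V assms by simp
    then show False using dist_adj_le[OF assms(2)] dist_eq_0[of a a'] V \<open>a \<noteq> a'\<close> by simp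
  qed
  ultimately have "d a' u = d a' v + 1 + d a u" using S(3)[of a' u] V assms by simp
  then show False using assms by simp
qed

text \<open>
  Every edge joins a vertex \<open>v \<noteq> c\<close> to its unique neighbour nearer to \<open>c\<close>.
\<close>

lemma sum_out_degree: "(\<Sum>x\<in>V. out_degree T x) + 2 = 2 * card V"
proof -
  obtain c where c: "c \<in> V" using verts_nonempty by auto
  \<comment> \<open>The arcs pointing towards \<open>c\<close>; their tails are distinct and differ
    from \<open>c\<close>.\<close>
  define U where "U = {(v, a) \<in> E. d v c = Suc (d a c)}"
  have "E \<subseteq> U \<union> U\<inverse>"
  proof
    fix e assume e: "e \<in> E"
    obtain x y where xy: "e = (x, y)" "(x, y) \<in> E" "x \<in> V" "y \<in> V"
      using e adj_verts by (cases e) auto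
    have "d x c \<le> 1 + d y c" "d y c \<le> 1 + d x c"
      using dist_triangle[of x y c] dist_triangle[of y x c] xy c
        dist_adj_le[OF xy(2)] dist_adj_le[OF adj_sym[OF xy(2)]] by auto
    then show "e \<in> U \<union> U\<inverse>"
      using dist_adj_neq[OF xy(2) c] xy adj_sym by (auto simp: U_def)
  qed
  moreover have "finite U" using finite_subset[of U E] finite_arcs by (auto simp: U_def)
  ultimately have "card E \<le> card (U \<union> U\<inverse>)" by (intro card_mono) auto
  also have "\<dots> \<le> card U + card (U\<inverse>)" by (rule card_Un_le)
  also have "card (U\<inverse>) = card U" by simp
  also have "card U \<le> card (V - {c})"
  proof (rule card_inj_on_le)
    show "inj_on fst U" using c parent_unique by (auto simp: inj_on_def U_def)
    show "fst ` U \<subseteq> V - {c}" using c adj_verts by (auto simp: U_def)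
  qed (use finite_verts in auto)
  finally have "card E \<le> 2 * (card V - 1)"
    using c finite_verts by (simp add: card_Diff_singleton)
  moreover have "card V \<ge> 1" using c finite_verts by (metis One_nat_def Suc_leI card_gt_0_iff empty_iff)
  moreover have "(\<Sum>x\<in>V. out_degree T x) = card E"
  proof -
    have "E = Sigma V (\<lambda>x. E `` {x})" using adj_verts by auto
    then show ?thesis using finite_verts finite_neighbours
      by (metis (no_types, lifting) card_SigmaI out_degree_eq sum.cong)
  qed
  \<comment> \<open>The opposite inequality comes from connectedness.\<close>
  ultimately show ?thesis using sum_out_degree_ge by simp
qed

section \<open>Eccentricities and the centre\<close>

text \<open>Take one step from \<open>z\<close> towards \<open>c\<close>. Vertices on the side of
  \<open>w\<close> come nearer by one; the others reach \<open>c\<close> only through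
  \<open>z\<close> and \<open>w\<close>, so their distance to \<open>w\<close> is at most
  \<open>ecc T c\<close>.\<close>

lemma ecc_neighbour_less:
  assumes "z \<in> V" "c \<in> V" "ecc T c < ecc T z"
  obtains w where "(z, w) \<in> E" "ecc T w < ecc T z"
proof -
  have "z \<noteq> c" using assms by auto
  then have "d z c \<noteq> 0" using dist_eq_0 assms by blast
  then obtain k where k: "d z c = Suc k" using not0_implies_Suc by blast
  obtain w where w: "(z, w) \<in> E" "d w c = k" using dist_Suc_neighbour[OF assms(1,2) k] by blast
  have wV: "w \<in> V" using w adj_verts by auto
  obtain S where S: "w \<in> S" "z \<notin> S"
    "\<And>x u. x \<in> V - S \<Longrightarrow> u \<in> V \<inter> S \<Longrightarrow> d x u = d x z + 1 + d w u"
    using edge_split[OF adj_sym[OF w(1)]] by blast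
  have "c \<in> S"
  proof (rule ccontr)
    assume "c \<notin> S"
    then have "d c w = d c z + 1" using S(3)[of c w] S wV assms by simp
    then show False using k w dist_sym wV assms by simp
  qed
  have "d u w \<le> ecc T z - 1" if u: "u \<in> V" for u
  proof (cases "u \<in> S")
    case True
    have "d z u = 1 + d w u" using S(3)[of z u] S True u assms by simp
    moreover have "d u z \<le> ecc T z" using ecc_le_iff[of z "ecc T z"] u assms by simp
    ultimately show ?thesis using dist_sym u wV assms by simp
  next
    case False
    have "d u c = d u z + 1 + d w c" "d u w = d u z + 1"
      using S(3)[of u c] S(3)[of u w] S False \<open>c \<in> S\<close> u wV assms by simp_all
    moreover have "d u c \<le> ecc T c" using ecc_le_iff[of c "ecc T c"] u assms by simp
    ultimately show ?thesis using assms by simp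
  qed
  then have "ecc T w \<le> ecc T z - 1" using ecc_le_iff wV by simp
  then show thesis using that w assms by simp
qed

text \<open>Otherwise the first vertex \<open>w\<close> on the way from \<open>c\<close> to
  \<open>c'\<close> has smaller eccentricity: it is nearer than \<open>c\<close> to the vertices on
  its side, and nearer than \<open>c'\<close> to the others.\<close>

lemma minimal_ecc_adjacent:
  assumes "c \<in> V" "c' \<in> V" "c \<noteq> c'" "ecc T c' = ecc T c" "\<And>z. z \<in> V \<Longrightarrow> ecc T c \<le> ecc T z"
  shows "(c, c') \<in> E"
proof (rule ccontr)
  assume nonadj: "(c, c') \<notin> E"
  have "d c c' \<noteq> 0" using dist_eq_0 assms by blast
  then obtain k where k: "d c c' = Suc k" using not0_implies_Suc by blast
  obtain w where w: "(c, w) \<in> E" "d w c' = k" using dist_Suc_neighbour[OF assms(1,2) k] by blast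
  have wV: "w \<in> V" using w adj_verts by auto
  obtain S where S: "w \<in> S" "c \<notin> S"
    "\<And>x u. x \<in> V - S \<Longrightarrow> u \<in> V \<inter> S \<Longrightarrow> d x u = d x c + 1 + d w u"
    using edge_split[OF adj_sym[OF w(1)]] by blast
  have "c' \<in> S"
  proof (rule ccontr)
    assume "c' \<notin> S"
    then have "d c' w = d c' c + 1" using S(3)[of c' w] S wV assms by simp
    then show False using k w dist_sym wV assms by simp
  qed
  \<comment> \<open>Non-adjacency enters here: it makes the comparison with \<open>c'\<close>
    strict.\<close>
  have "k \<noteq> 0" using w nonadj dist_eq_0[of w c'] wV assms by auto
  have "d u w < ecc T c" if u: "u \<in> V" for u
  proof (cases "u \<in> S")
    case True
    have "d c u = 1 + d w u" using S(3)[of c u] S True u assms by simp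
    moreover have "d u c \<le> ecc T c" using ecc_le_iff[of c "ecc T c"] u assms by simp
    ultimately show ?thesis using dist_sym u wV assms by simp
  next
    case False
    have "d u c' = d u c + 1 + d w c'" "d u w = d u c + 1"
      using S(3)[of u c'] S(3)[of u w] S False \<open>c' \<in> S\<close> u wV assms by simp_all
    moreover have "d u c' \<le> ecc T c" using ecc_le_iff[of c' "ecc T c"] u assms by simp
    ultimately show ?thesis using \<open>k \<noteq> 0\<close> w by simp
  qed
  then have "ecc T w \<le> ecc T c - 1" "ecc T c \<noteq> 0"
    using ecc_le_iff[of w "ecc T c - 1"] wV by fastforce+
  then show False using assms(5)[OF wV] by simp
qed

text \<open>The bound \<open>card C \<le> r + 1\<close> makes the covering radius a genuine
  difference: \<open>r\<close> for a single vertex, \<open>r - 1\<close> for an edge.\<close>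

lemma obtain_center:
  obtains r C where "C \<subseteq> V" "card C \<in> {1, 2}" "card C \<le> r + 1" "few_neighbours C"
    "V \<subseteq> (nbhd E ^^ (r + 1 - card C)) C"
    "\<And>k. {z \<in> V. ecc T z \<le> r + k} \<subseteq> (nbhd E ^^ k) C"
    "\<And>z. z \<in> V \<Longrightarrow> r \<le> ecc T z"
proof -
  obtain c where c: "c \<in> V" "\<And>z. z \<in> V \<Longrightarrow> ecc T c \<le> ecc T z"
    using ex_min_if_finite[of "ecc T ` V"] finite_verts verts_nonempty
    by (metis (mono_tags) arg_min_if_finite(1) arg_min_least)
  define C where "C = {z \<in> V. ecc T z = ecc T c}"
  have CV: "C \<subseteq> V" by (auto simp: C_def)
  \<comment> \<open>Each step to a neighbour of smaller eccentricity lowers it by at least one, so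
    at most \<open>k\<close> steps lead into \<open>C\<close>.\<close>
  have sub: "{z \<in> V. ecc T z \<le> ecc T c + k} \<subseteq> (nbhd E ^^ k) C" for k
  proof (induction k)
    case 0
    then show ?case using c by (auto simp: C_def intro: antisym)
  next
    case (Suc k)
    show ?case
    proof clarify
      fix z assume z: "z \<in> V" "ecc T z \<le> ecc T c + Suc k"
      show "z \<in> (nbhd E ^^ Suc k) C"
      proof (cases "z \<in> C")
        case True
        then show ?thesis using subset_nbhd_pow by blast
      next
        case False
        then have "ecc T c < ecc T z" using c(2)[OF z(1)] z by (auto simp: C_def)
        then obtain w where w: "(z, w) \<in> E" "ecc T w < ecc T z"
          using ecc_neighbour_less z c by blast
        then have "w \<in> (nbhd E ^^ k) C" using Suc z adj_verts by auto
        then show ?thesis using adj_sym[OF w(1)] by (auto simp: nbhd_def[of _ "(nbhd E ^^ k) C"])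
      qed
    qed
  qed
  have adj: "(x, y) \<in> E" if "x \<in> C" "y \<in> C" "x \<noteq> y" for x y
    using that c by (intro minimal_ecc_adjacent) (auto simp: C_def)
  have "c \<in> C" using c by (auto simp: C_def)
  show thesis
  proof (cases "C = {c}")
    case True
    have "V \<subseteq> (nbhd E ^^ ecc T c) {c}"
      using c ecc_le_iff[of c "ecc T c"] by (auto intro: dist_le_imp_nbhd_pow)
    then show thesis using that[of C "ecc T c"] CV sub c few_neighbours_singleton True by simp
  next
    case False
    then obtain c' where c': "c' \<in> C" "c' \<noteq> c" using \<open>c \<in> C\<close> by auto
    have cc': "(c, c') \<in> E" using adj c' \<open>c \<in> C\<close> by auto
    have "C = {c, c'}"
    proof (rule ccontr)
      assume "C \<noteq> {c, c'}"
      then obtain x where x: "x \<in> C" "x \<noteq> c" "x \<noteq> c'" using c' \<open>c \<in> C\<close> by auto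
      \<comment> \<open>A third central vertex would form a triangle, against bipartiteness.\<close>
      have "(c, x) \<in> E" "(c', x) \<in> E" using adj x c' \<open>c \<in> C\<close> by auto
      moreover have "c \<noteq> x" "c' \<noteq> x" "x \<in> V" "c' \<in> V" using x c' CV by auto
      ultimately have "d c x = 1" "d c' x = 1"
        using dist_adj_le[of c x] dist_adj_le[of c' x] dist_eq_0[of c x] dist_eq_0[of c' x] c
        by (metis le_0_eq le_antisym less_one linorder_not_le)+
      then show False using dist_adj_neq[OF cc' \<open>x \<in> V\<close>] by simp
    qed
    then have card: "card C = 2" using c' by simp
    have "c' \<in> V" and ecc': "ecc T c' = ecc T c" using c' by (auto simp: C_def)
    have "ecc T c \<noteq> 0"
    proof
      assume "ecc T c = 0"
      then have "d c' c = 0" using ecc_le_iff[of c 0] c \<open>c' \<in> V\<close> by simp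
      then show False using dist_eq_0 c \<open>c' \<in> V\<close> c' by blast
    qed
    have "few_neighbours (insert c' {c})"
      using cc' by (intro few_neighbours_insert few_neighbours_singleton) (auto simp: nbhd_def)
    then have "few_neighbours C" using \<open>C = {c, c'}\<close> by (simp add: insert_commute)
    \<comment> \<open>The distances from \<open>u\<close> to the two ends are at most
      \<open>ecc T c\<close> and differ, so one of them is smaller.\<close>
    moreover have "V \<subseteq> (nbhd E ^^ (ecc T c - 1)) C"
    proof
      fix u assume u: "u \<in> V"
      have "d u c \<le> ecc T c" "d u c' \<le> ecc T c"
        using u ecc_le_iff[of c "ecc T c"] ecc_le_iff[of c' "ecc T c"] c \<open>c' \<in> V\<close> ecc' by auto
      moreover have "d u c \<noteq> d u c'"
        using dist_adj_neq[OF cc' u] dist_sym u c \<open>c' \<in> V\<close> by metis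
      ultimately have "d u c \<le> ecc T c - 1 \<or> d u c' \<le> ecc T c - 1" by linarith
      then show "u \<in> (nbhd E ^^ (ecc T c - 1)) C"
        using dist_le_imp_nbhd_pow u c \<open>c' \<in> V\<close> \<open>c \<in> C\<close> c'(1) by blast
    qed
    ultimately show thesis
      using that[of C "ecc T c"] CV sub c card \<open>ecc T c \<noteq> 0\<close> by simp
  qed
qed

end

section \<open>Two inequalities for sums of natural numbers\<close>

text \<open>If the head is in \<open>M\<close>, it cancels. Otherwise \<open>M\<close> lies in the
  tail, and trading the last entry of the tail's prefix for the head does not decrease the
  sum.\<close>

lemma sum_mset_le_sum_list_take:
  fixes ds :: "nat list"
  assumes "sorted_wrt (\<ge>) ds" "M \<subseteq># mset ds"
  shows "\<Sum>\<^sub># M \<le> sum_list (take (size M) ds)"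
  using assms
proof (induction ds arbitrary: M)
  case Nil
  then show ?case by simp
next
  case (Cons x xs)
  show ?case
  proof (cases "x \<in># M")
    case True
    then obtain M' where M': "M = add_mset x M'" by (meson multi_member_split)
    then have "M' \<subseteq># mset xs" using Cons.prems by simp
    then have "\<Sum>\<^sub># M' \<le> sum_list (take (size M') xs)" using Cons by simp
    then show ?thesis using M' by simp
  next
    case False
    then have sub: "M \<subseteq># mset xs" using Cons.prems
      by (metis add_mset_remove_trivial diff_single_trivial mset.simps(2) subset_eq_diff_conv
          subset_mset.le_diff_conv2 add_mset_add_single)
    show ?thesis
    proof (cases "size M")
      case 0
      then show ?thesis by simp
    next
      case (Suc k)
      have "k < length xs" using size_mset_mono[OF sub] Suc by simp
      then have "sum_list (take (Suc k) xs) = sum_list (take k xs) + xs ! k" "xs ! k \<le> x"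
        using Cons.prems by (simp_all add: take_Suc_conv_app_nth)
      then show ?thesis using Cons.IH[OF _ sub] Cons.prems Suc by simp
    qed
  qed
qed

text \<open>Layer-cake summation: a sum of naturals counts, for each \<open>l\<close>, the elements
  with value above \<open>l\<close>.\<close>

lemma sum_le_if_sublevel_card_ge:
  fixes f :: "'a \<Rightarrow> nat" and g :: "'b \<Rightarrow> nat"
  assumes "finite A" "finite B" "card A = card B"
    and "\<And>l. card {a \<in> A. f a \<le> l} \<le> card {b \<in> B. g b \<le> l}"
  shows "sum g B \<le> sum f A"
proof -
  \<comment> \<open>A common bound for all values, so that both sums have the same layers.\<close>
  define N where "N = sum f A + sum g B"
  have layers: "sum h C = (\<Sum>l<N. card C - card {c \<in> C. h c \<le> l})"
    if "finite C" "\<And>c. c \<in> C \<Longrightarrow> h c \<le> N" for C :: "'c set" and h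
  proof -
    have "sum h C = (\<Sum>c\<in>C. \<Sum>l<N. of_bool (l < h c))"
    proof (rule sum.cong)
      fix c assume "c \<in> C"
      then have "{..<N} \<inter> {l. l < h c} = {..<h c}" using that(2)[of c] by auto
      then show "h c = (\<Sum>l<N. of_bool (l < h c))" by (simp add: sum_of_bool_eq)
    qed simp
    also have "\<dots> = (\<Sum>l<N. \<Sum>c\<in>C. of_bool (l < h c))" by (rule sum.swap)
    also have "\<dots> = (\<Sum>l<N. card C - card {c \<in> C. h c \<le> l})"
    proof (rule sum.cong)
      fix l
      have "C \<inter> {c. l < h c} = C - {c \<in> C. h c \<le> l}" by auto
      then show "(\<Sum>c\<in>C. of_bool (l < h c)) = card C - card {c \<in> C. h c \<le> l}"
        using that(1) by (simp add: sum_of_bool_eq card_Diff_subset)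
    qed simp
    finally show ?thesis .
  qed
  have "f a \<le> N" if "a \<in> A" for a
    using member_le_sum[of a A f] that assms(1) by (simp add: N_def)
  moreover have "g b \<le> N" if "b \<in> B" for b
    using member_le_sum[of b B g] that assms(2) by (simp add: N_def)
  ultimately show ?thesis
    using assms by (simp add: layers sum_mono diff_le_mono2)
qed

section \<open>The greedy tree\<close>

text \<open>
  Vertex \<open>0\<close> and the children of the vertices before \<open>m\<close> precede the children of \<open>m\<close> in the numbering.
\<close>

definition first_child :: "nat list \<Rightarrow> nat \<Rightarrow> nat" where
  "first_child ds m = 1 + (\<Sum>j<m. down_degree ds j)"

lemma first_child_0 [simp]: "first_child ds 0 = 1"
  by (simp add: first_child_def)

lemma first_child_Suc: "first_child ds (Suc m) = first_child ds m + down_degree ds m"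
  by (simp add: first_child_def)

lemma first_child_mono: "m \<le> m' \<Longrightarrow> first_child ds m \<le> first_child ds m'"
  by (induction rule: dec_induct) (auto simp: first_child_Suc)

lemma first_child_pos: "first_child ds m \<ge> 1"
  by (simp add: first_child_def)

lemma first_child_sum:
  "a \<le> k \<Longrightarrow> first_child ds a + (\<Sum>j\<in>{a..<k}. down_degree ds j) = first_child ds k"
  by (induction rule: dec_induct) (auto simp: first_child_Suc)

text \<open>The intervals from \<open>first_child ds k\<close> up to
  \<open>first_child ds (Suc k)\<close> tile the numbers from 1 on, leaving 0 as the root.\<close>

lemma parent_ex:
  assumes "1 \<le> c" "c < first_child ds m"
  obtains k where "k < m" "first_child ds k \<le> c" "c < first_child ds (Suc k)"
  using assms
proof (induction m arbitrary: thesis)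
  case (Suc m)
  then show ?case by (metis less_SucI lessI not_le)
qed auto

lemma parent_unique_index:
  assumes "first_child ds k \<le> c" "c < first_child ds (Suc k)"
    "first_child ds k' \<le> c" "c < first_child ds (Suc k')"
  shows "k = k'"
proof (rule ccontr)
  assume "k \<noteq> k'"
  then have "Suc k \<le> k' \<or> Suc k' \<le> k" by linarith
  then show False using assms first_child_mono[of "Suc k" k' ds] first_child_mono[of "Suc k'" k ds]
    by linarith
qed

text \<open>The numerical properties of a tree degree sequence from which the greedy tree is built.
  A one-vertex tree has degree 0, hence the guard in \<open>degree_pos\<close>.\<close>

locale tree_degrees =
  fixes ds :: "nat list"
  assumes sorted: "sorted_wrt (\<ge>) ds"
    and nonempty: "ds \<noteq> []"
    and sum_degrees: "sum_list ds + 2 = 2 * length ds"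
    and degree_pos: "length ds \<ge> 2 \<Longrightarrow> j < length ds \<Longrightarrow> ds ! j \<ge> 1"
begin

abbreviation "n \<equiv> length ds"
abbreviation "F \<equiv> first_child ds"
abbreviation "G \<equiv> greedy_tree ds"

lemma degree_mono: "i \<le> j \<Longrightarrow> j < n \<Longrightarrow> ds ! j \<le> ds ! i"
  using sorted by (cases "i = j") (auto simp: sorted_wrt_iff_nth_less)

text \<open>Identifies \<open>F m\<close> with the growth bound for \<open>m\<close> vertices of
  largest degree; positive degrees make the subtractions exact. At \<open>m = 0\<close> the two
  sides differ by one, since only the root lacks a parent.\<close>

lemma first_child_eq:
  assumes "1 \<le> m" "m \<le> n"
  shows "F m + m = 2 + sum_list (take m ds)"
  using assms
proof (induction m rule: dec_induct)
  case base
  then show ?case using nonempty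
    by (cases ds) (auto simp: first_child_def down_degree_def)
next
  case (step m)
  then have "ds ! m \<ge> 1" using degree_pos by simp
  then show ?case using step
    by (simp add: first_child_Suc down_degree_def take_Suc_conv_app_nth)
qed

lemma first_child_length: "F n = n"
  using first_child_eq[of n] sum_degrees nonempty by (simp add: Suc_le_eq)

lemma first_child_le: "m \<le> n \<Longrightarrow> F m \<le> n"
  using first_child_mono[of m n ds] first_child_length by simp

text \<open>
  As long as all degrees are at least 2 the bound is clear; afterwards only leaves remain, and
  \<open>F k = n\<close>.
\<close>

lemma first_child_gt:
  assumes "k < n"
  shows "k < F k"
proof (cases "k = 0")
  case False
  have eq: "F k + k = 2 + sum_list (take k ds)" using first_child_eq[of k] assms False by simp
  show ?thesis
  proof (cases "\<forall>j<k. ds ! j \<ge> 2")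
    case True
    have "(\<Sum>j<k. 2) \<le> (\<Sum>j<k. ds ! j)" using True by (intro sum_mono) auto
    then have "2 * k \<le> sum_list (take k ds)"
      using assms by (simp add: sum_list_sum_nth atLeast0LessThan min_def)
    then show ?thesis using eq by simp
  next
    case False
    then obtain j where j: "j < k" "ds ! j \<le> 1" by force
    have "sum_list (drop k ds) = (\<Sum>i<n - k. ds ! (k + i))"
      by (simp add: sum_list_sum_nth atLeast0LessThan)
    also have "\<dots> \<le> (\<Sum>i<n - k. 1)"
    proof (rule sum_mono)
      fix i assume "i \<in> {..<n - k}"
      then have "k + i < n" by auto
      then show "ds ! (k + i) \<le> 1" using degree_mono[of j "k + i"] j by linarith
    qed
    finally have "sum_list (drop k ds) \<le> n - k" by simp
    moreover have "sum_list ds = sum_list (take k ds) + sum_list (drop k ds)"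
      by (metis append_take_drop_id sum_list_append)
    ultimately show ?thesis using eq sum_degrees assms by linarith
  qed
qed simp

section \<open>Levels and arcs of the construction\<close>

lemma greedy_level_bounds:
  assumes "greedy_level ds h = (a, b)"
  shows "a \<le> n" "b = F a" "a \<le> b" "b \<le> n"
proof -
  have "a \<le> n \<and> b = F a \<and> a \<le> b \<and> b \<le> n"
    using assms
  proof (induction h arbitrary: a b)
    case 0
    then show ?case using nonempty by (auto simp: Suc_le_eq)
  next
    case (Suc h)
    obtain a' b' where ab: "greedy_level ds h = (a', b')" by fastforce
    then have IH: "a' \<le> n" "b' = F a'" "a' \<le> b'" "b' \<le> n" using Suc.IH by auto
    have *: "a = b'" "b = F b'" using Suc.prems ab IH first_child_sum[of a' b' ds] by auto
    \<comment> \<open>Once the vertices are used up, \<open>F n = n\<close> and all later levels are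
      empty.\<close>
    have "b' \<le> F b'" using first_child_gt[of b'] first_child_length IH(4) by (cases "b' = n") auto
    then show ?case using * IH first_child_le by auto
  qed
  then show "a \<le> n" "b = F a" "a \<le> b" "b \<le> n" by auto
qed

lemma greedy_level_cover:
  assumes "k < n"
  obtains h a b where "greedy_level ds h = (a, b)" "a \<le> k" "k < b"
proof -
  \<comment> \<open>From \<open>h < b\<close> follows \<open>Suc h < F (Suc h) \<le> F b\<close>, so
    the ends of the levels outrun their indices.\<close>
  have far: "h < n \<Longrightarrow> h < snd (greedy_level ds h)" for h
  proof (induction h)
    case (Suc h)
    obtain a b where ab: "greedy_level ds h = (a, b)" by fastforce
    have "h < b" using Suc ab by simp
    moreover have "snd (greedy_level ds (Suc h)) = F b"
      using greedy_level_bounds[OF ab] first_child_sum[of a b ds] ab by simp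
    moreover have "Suc h < F b"
      using first_child_gt[of "Suc h"] first_child_mono[of "Suc h" b ds] Suc.prems \<open>h < b\<close> by simp
    ultimately show ?case by simp
  qed simp
  have "k < snd (greedy_level ds h) \<Longrightarrow> \<exists>h a b. greedy_level ds h = (a, b) \<and> a \<le> k \<and> k < b" for h
  proof (induction h)
    case 0
    then have "greedy_level ds 0 = (0, 1)" "0 \<le> k" "k < 1" by simp_all
    then show ?case by blast
  next
    case (Suc h)
    show ?case
    proof (cases "k < snd (greedy_level ds h)")
      case False
      then have "fst (greedy_level ds (Suc h)) \<le> k" by (simp add: case_prod_beta)
      then show ?thesis using Suc.prems by (metis prod.collapse)
    qed (use Suc in blast)
  qed
  then show thesis using far[OF assms] that by blast
qed

text \<open>Levels disappear from the description: since \<open>b = F a\<close>, the offset of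
  \<open>k\<close> within its level telescopes to \<open>F k\<close>.\<close>

lemma greedy_arcs_iff: "(k, c) \<in> greedy_arcs ds \<longleftrightarrow> k < n \<and> F k \<le> c \<and> c < F (Suc k)"
proof
  assume "(k, c) \<in> greedy_arcs ds"
  then obtain h a b where h: "greedy_level ds h = (a, b)" "a \<le> k" "k < b"
    "c \<in> {b + (\<Sum>j\<in>{a..<k}. down_degree ds j)..<b + (\<Sum>j\<in>{a..<k}. down_degree ds j) + down_degree ds k}"
    by (auto simp: greedy_arcs_def Let_def)
  then show "k < n \<and> F k \<le> c \<and> c < F (Suc k)"
    using greedy_level_bounds[OF h(1)] first_child_sum[of a k ds] by (simp add: first_child_Suc)
next
  assume *: "k < n \<and> F k \<le> c \<and> c < F (Suc k)"
  obtain h a b where h: "greedy_level ds h = (a, b)" "a \<le> k" "k < b"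
    using greedy_level_cover * by blast
  have "c \<in> {b + (\<Sum>j\<in>{a..<k}. down_degree ds j)..<b + (\<Sum>j\<in>{a..<k}. down_degree ds j) + down_degree ds k}"
    using greedy_level_bounds[OF h(1)] first_child_sum[of a k ds] h(2) * by (simp add: first_child_Suc)
  then show "(k, c) \<in> greedy_arcs ds"
    using h unfolding greedy_arcs_def Let_def by auto
qed

lemma greedy_arc_bounds:
  assumes "(k, c) \<in> greedy_arcs ds"
  shows "k < c" "c < n"
  using assms first_child_gt[of k] first_child_le[of "Suc k"] by (auto simp: greedy_arcs_iff)

lemma greedy_parent_unique:
  assumes "(k, c) \<in> greedy_arcs ds" "(k', c) \<in> greedy_arcs ds"
  shows "k = k'"
  using assms parent_unique_index[of ds k c k'] by (simp add: greedy_arcs_iff)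

section \<open>The greedy tree is a tree with the given degrees\<close>

lemma pverts_greedy [simp]: "pverts G = {..<n}"
  by (simp add: greedy_tree_def)

lemma parcs_greedy: "parcs G = greedy_arcs ds \<union> (greedy_arcs ds)\<inverse>"
  by (simp add: greedy_tree_def)

lemma pair_graph_greedy: "pair_graph G"
proof -
  have sub: "parcs G \<subseteq> {..<n} \<times> {..<n}"
    using greedy_arc_bounds by (fastforce simp: parcs_greedy dest: less_trans)
  show ?thesis
  proof unfold_locales
    show "finite (parcs G)" using sub finite_subset by blast
    show "symmetric (with_proj G)" by (auto simp: symmetric_def parcs_greedy sym_Un_converse)
    show "fst e \<noteq> snd e" if "e \<in> parcs G" for e
      using that by (cases e) (auto simp: parcs_greedy dest: greedy_arc_bounds(1))
  qed (use sub in auto)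
qed

lemma connected_greedy: "connected G"
proof -
  interpret pair_graph G by (rule pair_graph_greedy)
  have root: "0 \<rightarrow>\<^sup>*\<^bsub>G\<^esub> c" if "c < n" for c
    using that
  proof (induction c rule: less_induct)
    case (less c)
    show ?case
    proof (cases "c = 0")
      case True
      then show ?thesis using nonempty by (simp add: reachable_refl)
    next
      case False
      \<comment> \<open>As \<open>c < F c\<close>, the parent of \<open>c\<close> has a smaller
        index.\<close>
      then obtain k where k: "k < c" "(k, c) \<in> greedy_arcs ds"
        using parent_ex[of c ds c] first_child_gt[of c] less.prems
        by (auto simp: greedy_arcs_iff)
      then have "0 \<rightarrow>\<^sup>*\<^bsub>G\<^esub> k" using less by simp
      moreover have "(k, c) \<in> parcs G" using k by (simp add: parcs_greedy)
      ultimately show ?thesis by (rule reachable_adj_trans)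
    qed
  qed
  have "u \<rightarrow>\<^sup>*\<^bsub>G\<^esub> v" if "u < n" "v < n" for u v
    using root[OF that(1)] root[OF that(2)] symmetric_reachable[OF sym_arcs] reachable_trans by blast
  then show ?thesis
    using nonempty by (simp add: connected_def strongly_connected_def reachable_mk_symmetric_eq sym_arcs
        lessThan_empty_iff)
qed

lemma pcas_nth:
  assumes "pcas u p v" "Suc i < length p"
  shows "fst (p ! Suc i) = snd (p ! i)"
  using assms
proof (induction p arbitrary: u i)
  case (Cons e p)
  then show ?case by (cases i; cases p) auto
qed simp

text \<open>
  On a cycle, both neighbours of the largest vertex would be its parent.
\<close>

lemma no_cycle_greedy: "\<not> (\<exists>p. pre_digraph.cycle (with_proj G) p \<and> length p \<ge> 3)"
proof
  interpret pair_graph G by (rule pair_graph_greedy)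
  assume "\<exists>p. pre_digraph.cycle (with_proj G) p \<and> length p \<ge> 3"
  then obtain p u where p: "awalk u p u" "distinct (tl (pawalk_verts u p))" "length p \<ge> 3"
    by (auto simp: cycle_def)
  have verts: "pawalk_verts u p = u # map snd p" if "pcas u p v" for u v
    using that by (induction p arbitrary: u) auto
  have cas: "pcas u p u" and arcs: "set p \<subseteq> parcs G" using p by (auto simp: awalk_def)
  have dist: "distinct (map snd p)" using p verts[OF cas] by simp
  \<comment> \<open>Cyclic successor of a position on the cycle.\<close>
  define nxt where "nxt i = (if Suc i = length p then 0 else Suc i)" for i
  have last: "snd (p ! (length p - 1)) = u"
  proof -
    have "p \<noteq> []" using p by auto
    moreover have "snd (last p) = v" if "pcas u p v" "p \<noteq> []" for u v
      using that by (induction p arbitrary: u) (auto split: if_splits)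
    ultimately show ?thesis using cas by (auto simp: last_conv_nth)
  qed
  have first: "fst (p ! 0) = u" using cas p by (cases p) auto
  have nxt: "fst (p ! nxt i) = snd (p ! i)" if "i < length p" for i
  proof (cases "Suc i = length p")
    case True
    then have "length p - 1 = i" by simp
    then show ?thesis using True last first by (simp add: nxt_def)
  next
    case False
    then show ?thesis using that pcas_nth[OF cas, of i] by (simp add: nxt_def)
  qed
  obtain e where e: "e \<in> set p" "\<And>e'. e' \<in> set p \<Longrightarrow> snd e' \<le> snd e"
  proof -
    have "Max (snd ` set p) \<in> snd ` set p" using p by (intro Max_in) auto
    then obtain e where e: "e \<in> set p" "snd e = Max (snd ` set p)" by auto
    show thesis by (rule that[OF e(1)]) (simp add: e(2))
  qed
  obtain i where i: "i < length p" "p ! i = e" using e by (auto simp: in_set_conv_nth)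
  define i0 where "i0 = (if i = 0 then length p - 1 else i - 1)"
  have i0: "i0 < length p" "nxt i0 = i" using i p by (auto simp: i0_def nxt_def)
  \<comment> \<open>Length at least 3 keeps the cyclic predecessor and successor of \<open>i\<close>
    apart.\<close>
  have i1: "nxt i < length p" "nxt i \<noteq> i0" using i p by (auto simp: i0_def nxt_def)
  have x: "fst (p ! i) = snd (p ! i0)" using nxt[OF i0(1)] i0 by simp
  have down: "(fst e, snd e) \<in> greedy_arcs ds"
    using e(2)[of "p ! i0"] e(1) arcs greedy_arc_bounds(1)[of "snd e" "fst e"] i0 i x
    by (cases e) (auto simp: parcs_greedy)
  have "(snd e, snd (p ! nxt i)) \<in> parcs G"
    using nxt[OF i(1)] i arcs i1 by (metis nth_mem prod.collapse subsetD)
  then have "(snd (p ! nxt i), snd e) \<in> greedy_arcs ds"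
    using e(2)[of "p ! nxt i"] greedy_arc_bounds(1)[of "snd e" "snd (p ! nxt i)"] i1
    by (auto simp: parcs_greedy)
  then have "snd (p ! nxt i) = snd (p ! i0)" using greedy_parent_unique down x i by metis
  then show False using dist i0 i1 by (metis length_map nth_eq_iff_index_eq nth_map)
qed

lemma undirected_tree_greedy: "undirected_tree G"
  by (simp add: undirected_tree_def pair_graph_greedy connected_greedy no_cycle_greedy)

sublocale greedy: undirected_tree_graph G
  using undirected_tree_greedy by (simp add: undirected_tree_iff)

text \<open>The neighbours are the interval of children, all larger than \<open>k\<close>, and for
  \<open>k \<noteq> 0\<close> the one smaller parent, which restores the 1 subtracted in
  \<open>down_degree\<close>.\<close>

lemma out_degree_greedy:
  assumes "k < n"
  shows "out_degree G k = ds ! k"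
proof -
  have children: "{c. (k, c) \<in> greedy_arcs ds} = {F k..<F (Suc k)}"
    using assms by (auto simp: greedy_arcs_iff)
  have N: "parcs G `` {k} = {F k..<F (Suc k)} \<union> {j. (j, k) \<in> greedy_arcs ds}"
    using children by (auto simp: parcs_greedy)
  show ?thesis
  proof (cases "k = 0")
    case True
    then have "{j. (j, k) \<in> greedy_arcs ds} = {}" using greedy_arc_bounds(1) by auto
    then show ?thesis using N True
      by (simp add: greedy.out_degree_eq first_child_Suc down_degree_def)
  next
    case False
    then obtain j where j: "(j, k) \<in> greedy_arcs ds" "j < k"
      using parent_ex[of k ds k] first_child_gt[OF assms] assms
      by (auto simp: greedy_arcs_iff)
    then have "{j. (j, k) \<in> greedy_arcs ds} = {j}" using greedy_parent_unique by auto
    moreover have "j \<notin> {F k..<F (Suc k)}" using j first_child_gt[OF assms] by simp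
    moreover have "ds ! k \<ge> 1" using degree_pos assms False by simp
    ultimately show ?thesis using N False
      by (simp add: greedy.out_degree_eq first_child_Suc down_degree_def)
  qed
qed

lemma has_degree_sequence_greedy: "has_degree_sequence G ds"
proof -
  have "image_mset (out_degree G) (mset_set {..<n}) = image_mset ((!) ds) (mset_set {..<n})"
    by (intro image_mset_cong) (simp add: out_degree_greedy)
  also have "\<dots> = mset (map ((!) ds) [0..<n])"
    by (simp add: atLeast0LessThan)
  also have "\<dots> = mset ds" by (simp add: map_nth)
  finally show ?thesis by (simp add: has_degree_sequence_def)
qed

section \<open>Distances and eccentricities in the greedy tree\<close>

lemma first_child_pow_bounds:
  assumes "1 \<le> q" "q \<le> n"
  shows "1 \<le> (F ^^ k) q" "(F ^^ k) q \<le> n"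
proof -
  have "1 \<le> (F ^^ k) q \<and> (F ^^ k) q \<le> n"
    by (induction k) (use assms first_child_pos first_child_le in auto)
  then show "1 \<le> (F ^^ k) q" "(F ^^ k) q \<le> n" by auto
qed

text \<open>Passing to the parent maps nonzero vertices below \<open>F m\<close> to vertices below
  \<open>m\<close>; repeating this \<open>k\<close> times ends below \<open>q\<close>.\<close>

lemma greedy_dist_initial:
  assumes "1 \<le> q" "q \<le> n" "z < (F ^^ k) q"
  obtains y where "y < q" "graph_dist G z y \<le> k"
proof -
  have "\<exists>y<q. graph_dist G z y \<le> k" using assms(3)
  proof (induction k arbitrary: z)
    case 0
    then show ?case using assms by (intro exI[of _ z]) simp
  next
    case (Suc k)
    let ?m = "(F ^^ k) q"
    have m: "1 \<le> ?m" "?m \<le> n" using first_child_pow_bounds assms by auto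
    have z: "z < n" using Suc.prems first_child_le[OF m(2)] by simp
    show ?case
    proof (cases "z = 0")
      case True
      then show ?thesis using assms z by (intro exI[of _ 0]) simp
    next
      case False
      then obtain p where p: "p < ?m" "F p \<le> z" "z < F (Suc p)"
        using parent_ex[of z ds ?m] Suc.prems by auto
      then obtain y where y: "y < q" "graph_dist G p y \<le> k" using Suc.IH by blast
      have "(z, p) \<in> parcs G" using p m by (simp add: parcs_greedy greedy_arcs_iff)
      then have "graph_dist G z p \<le> 1" by (rule greedy.dist_adj_le)
      then have "graph_dist G z y \<le> Suc k"
        using greedy.dist_triangle[of z p y] y z p m assms by simp
      then show ?thesis using y by blast
    qed
  qed
  then show thesis using that by blast
qed

text \<open>The first \<open>q\<close> vertices form a vertex or an edge, of diameter
  \<open>q - 1\<close>. Going from \<open>u\<close> into this set, across it and out to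
  \<open>z\<close> costs at most \<open>(r + 1 - q) + (q - 1) + k\<close>.\<close>

lemma ecc_greedy_le:
  assumes "q \<in> {1, 2}" "q \<le> n" "q \<le> r + 1" "n \<le> (F ^^ (r + 1 - q)) q" "z < (F ^^ k) q"
  shows "ecc G z \<le> r + k"
proof -
  have q: "1 \<le> q" using assms by auto
  have z: "z < n" using first_child_pow_bounds(2)[OF q assms(2), of k] assms(5) by simp
  have close: "graph_dist G x y \<le> q - 1" if "x < q" "y < q" for x y
  proof (cases "x = y")
    case True
    then show ?thesis using that assms by simp
  next
    case False
    then have q2: "q = 2" using that assms by auto
    have "(0, 1) \<in> greedy_arcs ds"
      using first_child_gt[of 1] q2 assms nonempty by (simp add: greedy_arcs_iff)
    moreover have "{x, y} = {0, 1}" using False that q2 by auto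
    ultimately have "(x, y) \<in> parcs G" by (auto simp: parcs_greedy doubleton_eq_iff)
    then show ?thesis using greedy.dist_adj_le q2 by fastforce
  qed
  obtain y where y: "y < q" "graph_dist G z y \<le> k"
    using greedy_dist_initial[OF q assms(2,5)] by blast
  have "graph_dist G u z \<le> r + k" if u: "u < n" for u
  proof -
    obtain x where x: "x < q" "graph_dist G u x \<le> r + 1 - q"
      using greedy_dist_initial[OF q assms(2)] u assms(4) less_le_trans by metis
    have "graph_dist G u z \<le> graph_dist G u x + (graph_dist G x y + graph_dist G y z)"
      using greedy.dist_triangle[of u x z] greedy.dist_triangle[of x y z] u x y z assms by simp
    also have "\<dots> \<le> (r + 1 - q) + ((q - 1) + k)"
      using x y close[of x y] greedy.dist_sym[of y z] z assms by (intro add_mono) auto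
    finally show ?thesis using assms q by simp
  qed
  then show ?thesis using greedy.ecc_le_iff z by simp
qed

end

section \<open>Comparison with the greedy tree\<close>

context undirected_tree_graph
begin

lemma length_degree_sequence:
  assumes "has_degree_sequence T ds"
  shows "length ds = card V"
  using assms arg_cong[of _ _ size]
  by (metis has_degree_sequence_def size_image_mset size_mset size_mset_set)

lemma tree_degrees:
  assumes "has_degree_sequence T ds" "sorted_wrt (\<ge>) ds"
  shows "tree_degrees ds"
proof
  have len: "length ds = card V" using assms length_degree_sequence by simp
  have img: "image_mset (out_degree T) (mset_set V) = mset ds"
    using assms by (simp add: has_degree_sequence_def)
  show "ds \<noteq> []" using len verts_nonempty finite_verts by auto
  have "sum_list ds = (\<Sum>x\<in>V. out_degree T x)"
    using img by (metis sum_mset_sum_list sum_unfold_sum_mset)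
  then show "sum_list ds + 2 = 2 * length ds" using sum_out_degree len by simp
  show "ds ! j \<ge> 1" if "length ds \<ge> 2" "j < length ds" for j
  proof -
    have "ds ! j \<in># image_mset (out_degree T) (mset_set V)" using that img by simp
    then show ?thesis using out_degree_pos that len finite_verts by auto
  qed
qed fact

lemma sum_out_degree_le:
  assumes "has_degree_sequence T ds" "sorted_wrt (\<ge>) ds" "B \<subseteq> V"
  shows "(\<Sum>x\<in>B. out_degree T x) \<le> sum_list (take (card B) ds)"
proof -
  have "image_mset (out_degree T) (mset_set B) \<subseteq># mset ds"
    using assms finite_verts
    by (metis has_degree_sequence_def image_mset_subseteq_mono subset_imp_msubset_mset_set)
  then show ?thesis
    using sum_mset_le_sum_list_take[OF assms(2)] by (metis size_image_mset size_mset_set sum_unfold_sum_mset)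
qed

text \<open>A ball of \<open>m\<close> vertices has degree sum at most that of the \<open>m\<close>
  largest degrees, so the next ball has at most \<open>F m\<close> vertices; monotonicity of
  \<open>F\<close> carries the induction.\<close>

lemma card_nbhd_pow_le:
  assumes "has_degree_sequence T ds" "sorted_wrt (\<ge>) ds"
    and "few_neighbours C" "C \<subseteq> V" "C \<noteq> {}"
  shows "card ((nbhd E ^^ k) C) \<le> (first_child ds ^^ k) (card C)"
proof (induction k)
  case (Suc k)
  interpret tree_degrees ds using tree_degrees assms by blast
  let ?B = "(nbhd E ^^ k) C"
  have BV: "?B \<subseteq> V" using nbhd_pow_subset_verts assms by simp
  then have B: "card ?B \<le> length ds" "1 \<le> card ?B"
    using length_degree_sequence[OF assms(1)] finite_verts card_mono[of V ?B]
      subset_nbhd_pow[of C k] assms finite_subset[OF BV]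
    by (auto simp: Suc_le_eq card_gt_0_iff)
  have "card (nbhd E ?B) + card ?B \<le> 2 + (\<Sum>x\<in>?B. out_degree T x)"
    using few_neighbours_nbhd_pow[of C k] assms by (simp add: few_neighbours_def)
  also have "\<dots> \<le> 2 + sum_list (take (card ?B) ds)"
    using sum_out_degree_le assms BV by simp
  also have "\<dots> = first_child ds (card ?B) + card ?B" using first_child_eq B by simp
  finally have "card (nbhd E ?B) \<le> first_child ds (card ?B)" by simp
  also have "\<dots> \<le> first_child ds ((first_child ds ^^ k) (card C))"
    by (rule first_child_mono) (rule Suc)
  finally show ?case by simp
qed simp

lemma card_ecc_le_greedy:
  assumes "has_degree_sequence T ds" "sorted_wrt (\<ge>) ds"
  shows "card {z \<in> V. ecc T z \<le> l}
    \<le> card {z \<in> pverts (greedy_tree ds). ecc (greedy_tree ds) z \<le> l}"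
proof -
  interpret D: tree_degrees ds using tree_degrees assms by blast
  have n: "length ds = card V" using length_degree_sequence assms by simp
  obtain r C where C: "C \<subseteq> V" "card C \<in> {1, 2}" "card C \<le> r + 1" "few_neighbours C"
    "V \<subseteq> (nbhd E ^^ (r + 1 - card C)) C"
    "\<And>k. {z \<in> V. ecc T z \<le> r + k} \<subseteq> (nbhd E ^^ k) C"
    "\<And>z. z \<in> V \<Longrightarrow> r \<le> ecc T z"
    by (rule obtain_center) (rule that)
  have "C \<noteq> {}" using C(2) by auto
  have fin: "finite ((nbhd E ^^ k) C)" for k
    using nbhd_pow_subset_verts C(1) finite_verts finite_subset by blast
  have growth: "card ((nbhd E ^^ k) C) \<le> (first_child ds ^^ k) (card C)" for k
    using card_nbhd_pow_le assms C \<open>C \<noteq> {}\<close> by blast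
  have q: "card C \<le> length ds" "1 \<le> card C"
    using n C(1,2) finite_verts by (auto simp: card_mono)
  \<comment> \<open>The ball of this radius is all of \<open>V\<close>, so the iterate that bounds
    it reaches every greedy vertex.\<close>
  have all: "length ds \<le> (first_child ds ^^ (r + 1 - card C)) (card C)"
    using card_mono[OF fin C(5)] growth[of "r + 1 - card C"] n by simp
  show ?thesis
  proof (cases "r \<le> l")
    case False
    then have "{z \<in> V. ecc T z \<le> l} = {}" using C(7) by fastforce
    then show ?thesis by (metis card.empty le0)
  next
    case True
    then obtain k where l: "l = r + k" using le_Suc_ex by blast
    let ?m = "(first_child ds ^^ k) (card C)"
    have "card {z \<in> V. ecc T z \<le> l} \<le> ?m"
      using card_mono[OF fin C(6)[of k]] growth[of k] l by simp
    also have "?m = card {..<?m}" by simp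
    also have "{..<?m} \<subseteq> {z \<in> pverts (greedy_tree ds). ecc (greedy_tree ds) z \<le> l}"
      using D.ecc_greedy_le[OF C(2) q(1) C(3) all] D.first_child_pow_bounds(2)[OF q(2,1), of k] l
      by auto
    then have "card {..<?m} \<le> card {z \<in> pverts (greedy_tree ds). ecc (greedy_tree ds) z \<le> l}"
      by (intro card_mono) auto
    finally show ?thesis .
  qed
qed

end

theorem theorem3p8:
  fixes \<l> :: nat and ds :: "nat list"
  assumes "tree_degree_sequence ds" and "sorted_wrt (\<ge>) ds"
  shows "undirected_tree (greedy_tree ds) \<and> has_degree_sequence (greedy_tree ds) ds \<and>
    (\<forall>T :: 'a pair_pre_digraph. undirected_tree T \<and> has_degree_sequence T ds \<longrightarrow>
       card {z \<in> pverts T. ecc T z \<le> \<l>}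
         \<le> card {z \<in> pverts (greedy_tree ds). ecc (greedy_tree ds) z \<le> \<l>}) \<and>
    (\<forall>T :: 'a pair_pre_digraph. undirected_tree T \<and> has_degree_sequence T ds \<longrightarrow>
       Ecc (greedy_tree ds) \<le> Ecc T)"
proof -
  \<comment> \<open>The witness is a tree on natural numbers, because \<open>'a\<close> may be too
    small to carry any tree with these degrees.\<close>
  interpret D: tree_degrees ds
    using assms undirected_tree_graph.tree_degrees
    unfolding tree_degree_sequence_def undirected_tree_iff by blast
  have count: "card {z \<in> pverts T. ecc T z \<le> l}
      \<le> card {z \<in> pverts (greedy_tree ds). ecc (greedy_tree ds) z \<le> l}"
    if "undirected_tree T" "has_degree_sequence T ds" for T :: "'a pair_pre_digraph" and l
    using that assms undirected_tree_graph.card_ecc_le_greedy undirected_tree_iff by blast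
  have "Ecc (greedy_tree ds) \<le> Ecc T"
    if T: "undirected_tree T" "has_degree_sequence T ds" for T :: "'a pair_pre_digraph"
  proof -
    interpret undirected_tree_graph T using T by (simp add: undirected_tree_iff)
    \<comment> \<open>Both trees have \<open>length ds\<close> vertices, so the counts for all
      thresholds compare the sums.\<close>
    show ?thesis
      unfolding Ecc_def using count[OF T] length_degree_sequence[OF T(2)] finite_verts
      by (intro sum_le_if_sublevel_card_ge) auto
  qed
  then show ?thesis
    using D.undirected_tree_greedy D.has_degree_sequence_greedy count by blast
qed

end
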